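(* Let $p_3=1$ and $\rho>0$, and consider the system $$\mathcal{D}'=-2p_3\mathcal{I}\mathcal{R},\qquad\mathcal{R}'=-2p_3\mathcal{I}\mathcal{D},\qquad\mathcal{I}'=4p_3\mathcal{D}\mathcal{R}$$ on $S^2_\rho$. The six points $\pm(\rho,0,0),\pm(0,\rho,0),\pm(0,0,\rho)$ are fixed points. Further, the triplet $(f,g,h)=(2p_3\mathcal{I},\sqrt8\,p_3\mathcal{R},\sqrt8\,p_3\mathcal{D})$ solves $$f'=gh,\qquad g'=-fh,\qquad h'=-fg,$$ and hence the solution $(\mathcal{D},\mathcal{R},\mathcal{I})$ is given explicitly in terms of elementary functions and Jacobi elliptic functions through the following formulas. Let $(f_0,g_0,h_0)$ be the value of $(f,g,h)$ at time $0$, $R_{fg}=\sqrt{f_0^2+g_0^2}$, $R_{fh}=\sqrt{f_0^2+h_0^2}$, and suppose $R_{fh}\ge R_{fg}$. (i) If $R_{fg}=0$, then $f(t)=0$, $g(t)=0$, $h(t)=h_0$. (ii) If $R_{fh}>R_{fg}>0$, then $h_0\ne0$ and, with $m=R_{fg}^2/R_{fh}^2$ and $\varsigma=\operatorname{sign}h_0$, $$f(t)=R_{fg}\operatorname{sn}(\varsigma R_{fh}t+t_0,m),\quad g(t)=R_{fg}\operatorname{cn}(\varsigma R_{fh}t+t_0,m),\quad h(t)=\varsigma R_{fh}\operatorname{dn}(\varsigma R_{fh}t+t_0,m),$$ where $t_0$ is given by $(\operatorname{sn}(t_0,m),\operatorname{cn}(t_0,m))=(f_0/R_{fg},g_0/R_{fg})$.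 (iii) If $R_{fh}=R_{fg}>0$ and $g_0=h_0=0$, then $f(t)=f_0$, $g(t)=0$, $h(t)=0$. (iv) If $R_{fh}=R_{fg}>0$ and $g_0\ne0$, then $|h_0|=|g_0|>0$ and, with $\varsigma=\operatorname{sign}(g_0h_0)$ and $t_0=\tanh^{-1}(f_0/R_{fh})$, $$f(t)=R_{fh}\tanh(\varsigma R_{fh}t+t_0),\quad g(t)=(\operatorname{sign}g_0)R_{fh}\operatorname{sech}(\varsigma R_{fh}t+t_0),\quad h(t)=(\operatorname{sign}h_0)R_{fh}\operatorname{sech}(\varsigma R_{fh}t+t_0).$$ In all cases $f^2+g^2$ and $f^2+h^2$ are conserved, equal to $R_{fg}^2$ and $R_{fh}^2$ respectively; the formula in the case $R_{fh}<R_{fg}$ is obtained by swapping the roles of $g$ and $h$.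
   Context: $S^2_\rho=\{(x,y,z)\in\mathbb{R}^3: x^2+y^2+z^2=\rho^2\}$; the unknown $(\mathcal{D},\mathcal{R},\mathcal{I})$ is real valued with initial data in $S_\rho^2$, and the system preserves $S^2_\rho$. Jacobi elliptic functions with parameter $m\in[0,1)$: for $u\in\mathbb{R}$ define $\phi$ by $u=\int_0^\phi\frac{d\theta}{\sqrt{1-m\sin^2\theta}}$; then $\operatorname{sn}(u,m)=\sin\phi$, $\operatorname{cn}(u,m)=\cos\phi$, $\operatorname{dn}(u,m)=\sqrt{1-m\sin^2\phi}$. *)

theory Defs
  imports "HOL-Analysis.Analysis"
begin

definition sphere2 :: "real \<Rightarrow> (real \<times> real \<times> real) set" where
  "sphere2 \<rho> = {(x, y, z). x\<^sup>2 + y\<^sup>2 + z\<^sup>2 = \<rho>\<^sup>2}"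

definition DRI_field :: "real \<Rightarrow> real \<times> real \<times> real \<Rightarrow> real \<times> real \<times> real" where
  "DRI_field p3 = (\<lambda>(D, R, I). (- 2 * p3 * I * R, - 2 * p3 * I * D, 4 * p3 * D * R))"

definition DRI_fixed_point :: "real \<Rightarrow> real \<Rightarrow> real \<times> real \<times> real \<Rightarrow> bool" where
  "DRI_fixed_point p3 \<rho> p \<longleftrightarrow> p \<in> sphere2 \<rho> \<and> DRI_field p3 p = 0"

(* Derivatives are taken within J, i.e. one-sided at an endpoint belonging to J. *)
definition DRI_solution ::
    "real \<Rightarrow> real set \<Rightarrow> (real \<Rightarrow> real) \<Rightarrow> (real \<Rightarrow> real) \<Rightarrow> (real \<Rightarrow> real) \<Rightarrow> bool" where
  "DRI_solution p3 J D R I \<longleftrightarrow>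
     (\<forall>t\<in>J. ((\<lambda>s. (D s, R s, I s)) has_vector_derivative DRI_field p3 (D t, R t, I t)) (at t within J))"

definition fgh_solution ::
    "real set \<Rightarrow> (real \<Rightarrow> real) \<Rightarrow> (real \<Rightarrow> real) \<Rightarrow> (real \<Rightarrow> real) \<Rightarrow> bool" where
  "fgh_solution J f g h \<longleftrightarrow>
     (\<forall>t\<in>J. (f has_real_derivative g t * h t) (at t within J) \<and>
            (g has_real_derivative - (f t * h t)) (at t within J) \<and>
            (h has_real_derivative - (f t * g t)) (at t within J))"

(* The second argument of the elliptic functions is the parameter m (the square of the modulus),
   0 \<le> m < 1; outside this range jacobi_am is not meaningful. The interval integral is
   oriented, so negative amplitudes are covered. *)
definition jacobi_am :: "real \<Rightarrow> real \<Rightarrow> real" where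
  "jacobi_am u m = (THE \<phi>. u = (LBINT \<theta>=0..\<phi>. 1 / sqrt (1 - m * (sin \<theta>)\<^sup>2)))"

definition jacobi_sn :: "real \<Rightarrow> real \<Rightarrow> real" where
  "jacobi_sn u m = sin (jacobi_am u m)"

definition jacobi_cn :: "real \<Rightarrow> real \<Rightarrow> real" where
  "jacobi_cn u m = cos (jacobi_am u m)"

definition jacobi_dn :: "real \<Rightarrow> real \<Rightarrow> real" where
  "jacobi_dn u m = sqrt (1 - m * (sin (jacobi_am u m))\<^sup>2)"

definition sech :: "real \<Rightarrow> real" where
  "sech x = 1 / cosh x"

definition radius0 :: "(real \<Rightarrow> real) \<Rightarrow> (real \<Rightarrow> real) \<Rightarrow> real" where
  "radius0 f g = sqrt ((f 0)\<^sup>2 + (g 0)\<^sup>2)"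

(* Intended for radius0 f h \<ge> radius0 f g; the opposite case is explicit_formulas J f h g.
   In the elliptic case t0 is determined only up to a period: a valid phase exists, and the
   formulas hold for every valid phase. *)
definition explicit_formulas ::
    "real set \<Rightarrow> (real \<Rightarrow> real) \<Rightarrow> (real \<Rightarrow> real) \<Rightarrow> (real \<Rightarrow> real) \<Rightarrow> bool" where
  "explicit_formulas J f g h \<longleftrightarrow>
     (let Rfg = radius0 f g; Rfh = radius0 f h in
       (Rfg = 0 \<longrightarrow> (\<forall>t\<in>J. f t = 0 \<and> g t = 0 \<and> h t = h 0)) \<and>
       (Rfh > Rfg \<and> Rfg > 0 \<longrightarrow>
          h 0 \<noteq> 0 \<and>
          (let m = Rfg\<^sup>2 / Rfh\<^sup>2; \<sigma> = sgn (h 0);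
               phase = (\<lambda>t0. (jacobi_sn t0 m, jacobi_cn t0 m) = (f 0 / Rfg, g 0 / Rfg)) in
            (\<exists>t0. phase t0) \<and>
            (\<forall>t0. phase t0 \<longrightarrow>
               (\<forall>t\<in>J. f t = Rfg * jacobi_sn (\<sigma> * Rfh * t + t0) m \<and>
                      g t = Rfg * jacobi_cn (\<sigma> * Rfh * t + t0) m \<and>
                      h t = \<sigma> * Rfh * jacobi_dn (\<sigma> * Rfh * t + t0) m)))) \<and>
       (Rfh = Rfg \<and> Rfg > 0 \<and> g 0 = 0 \<and> h 0 = 0 \<longrightarrow>
          (\<forall>t\<in>J. f t = f 0 \<and> g t = 0 \<and> h t = 0)) \<and>
       (Rfh = Rfg \<and> Rfg > 0 \<and> g 0 \<noteq> 0 \<longrightarrow>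
          \<bar>h 0\<bar> = \<bar>g 0\<bar> \<and> \<bar>g 0\<bar> > 0 \<and>
          (let \<sigma> = sgn (g 0 * h 0); t0 = artanh (f 0 / Rfh) in
            (\<forall>t\<in>J. f t = Rfh * tanh (\<sigma> * Rfh * t + t0) \<and>
                   g t = sgn (g 0) * Rfh * sech (\<sigma> * Rfh * t + t0) \<and>
                   h t = sgn (h 0) * Rfh * sech (\<sigma> * Rfh * t + t0)))))"

end

theory Submission
  imports Defs
begin

text \<open>The quantities \<open>f\<^sup>2 + g\<^sup>2\<close> and \<open>f\<^sup>2 + h\<^sup>2\<close> are first integrals, so all
  solutions are bounded and the quadratic field is Lipschitz along them; a Gronwall argument
  then gives uniqueness on any interval. It remains to check that the listed functions solve
  the system with the right initial data. For the elliptic ones this is the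
  computation of the derivatives of \<open>sn\<close>, \<open>cn\<close> and \<open>dn\<close>, where the amplitude is
  the inverse of the incomplete elliptic integral.\<close>

section \<open>Incomplete elliptic integral and Jacobi amplitude\<close>

text \<open>Legendre's incomplete integral of the first kind, with \<open>m\<close> the square of
  the modulus. It is named so that \<open>jacobi_am\<close> can be treated as its inverse.\<close>

definition elliptic_F :: "real \<Rightarrow> real \<Rightarrow> real" where
  "elliptic_F \<phi> m = (LBINT \<theta>=0..\<phi>. 1 / sqrt (1 - m * (sin \<theta>)\<^sup>2))"

lemma elliptic_radicand_bounds:
  fixes m :: real
  assumes "0 \<le> m" "m < 1"
  shows "0 < 1 - m * (sin \<theta>)\<^sup>2" "1 - m * (sin \<theta>)\<^sup>2 \<le> 1"
proof -
  have "(sin \<theta>)\<^sup>2 \<le> 1" by (simp add: abs_square_le_1)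
  then have "m * (sin \<theta>)\<^sup>2 \<le> m * 1" using assms by (intro mult_left_mono) auto
  then show "0 < 1 - m * (sin \<theta>)\<^sup>2" using assms by linarith
  show "1 - m * (sin \<theta>)\<^sup>2 \<le> 1" using assms by simp
qed

lemma elliptic_F_0 [simp]: "elliptic_F 0 m = 0"
  by (simp add: elliptic_F_def flip: zero_ereal_def)

lemma elliptic_F_deriv:
  assumes "0 \<le> m" "m < 1"
  shows "((\<lambda>\<phi>. elliptic_F \<phi> m) has_real_derivative 1 / sqrt (1 - m * (sin \<phi>)\<^sup>2)) (at \<phi>)"
proof -
  \<comment> \<open>The interval from \<open>-b\<close> to \<open>b\<close> contains the base point
    0 and has \<open>\<phi>\<close> in its interior, so the derivative within it is the full
    derivative.\<close>
  define b where "b = \<bar>\<phi>\<bar> + 1"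
  have "continuous_on {-b..b} (\<lambda>\<theta>. 1 / sqrt (1 - m * (sin \<theta>)\<^sup>2))"
    using elliptic_radicand_bounds(1)[OF assms] by (intro continuous_intros) (auto simp: less_imp_neq[symmetric])
  then have "((\<lambda>u. LBINT \<theta>=ereal 0..ereal u. 1 / sqrt (1 - m * (sin \<theta>)\<^sup>2)) has_vector_derivative
      1 / sqrt (1 - m * (sin \<phi>)\<^sup>2)) (at \<phi> within {-b..b})"
    by (intro interval_integral_FTC2) (auto simp: b_def)
  moreover have "at \<phi> within {-b..b} = at \<phi>"
    by (rule at_within_Icc_at) (auto simp: b_def)
  ultimately show ?thesis
    by (simp add: elliptic_F_def has_real_derivative_iff_has_vector_derivative flip: zero_ereal_def)
qed

text \<open>The integrand is at least 1, so \<open>elliptic_F\<close> minus the identity is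
  nondecreasing. This one estimate yields both injectivity and surjectivity.\<close>

lemma elliptic_F_expanding:
  assumes "0 \<le> m" "m < 1" "\<phi> \<le> \<psi>"
  shows "\<psi> - \<phi> \<le> elliptic_F \<psi> m - elliptic_F \<phi> m"
proof -
  have "elliptic_F \<phi> m - \<phi> \<le> elliptic_F \<psi> m - \<psi>"
  proof (rule DERIV_nonneg_imp_nondecreasing[OF assms(3)], intro exI conjI)
    fix x
    show "((\<lambda>x. elliptic_F x m - x) has_real_derivative 1 / sqrt (1 - m * (sin x)\<^sup>2) - 1) (at x)"
      by (intro derivative_intros elliptic_F_deriv assms)
    have "sqrt (1 - m * (sin x)\<^sup>2) \<le> 1" "0 < sqrt (1 - m * (sin x)\<^sup>2)"
      using elliptic_radicand_bounds[OF assms(1,2), of x] by auto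
    then show "0 \<le> 1 / sqrt (1 - m * (sin x)\<^sup>2) - 1" by simp
  qed
  then show ?thesis by simp
qed

text \<open>Expansion away from \<open>elliptic_F 0 m = 0\<close> puts \<open>u\<close> between the
  values at \<open>-\<bar>u\<bar>\<close> and \<open>\<bar>u\<bar>\<close>, so the intermediate
  value theorem applies; expansion also forces injectivity. Hence the definite description in
  \<open>jacobi_am\<close> is meaningful.\<close>

lemma elliptic_F_ex1:
  assumes "0 \<le> m" "m < 1"
  shows "\<exists>!\<phi>. u = elliptic_F \<phi> m"
proof -
  have "\<exists>\<phi>\<ge>-\<bar>u\<bar>. \<phi> \<le> \<bar>u\<bar> \<and> elliptic_F \<phi> m = u"
  proof (rule IVT')
    show "elliptic_F (- \<bar>u\<bar>) m \<le> u" "u \<le> elliptic_F \<bar>u\<bar> m"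
      using elliptic_F_expanding[OF assms, of "-\<bar>u\<bar>" 0] elliptic_F_expanding[OF assms, of 0 "\<bar>u\<bar>"]
      by auto
    show "continuous_on {-\<bar>u\<bar>..\<bar>u\<bar>} (\<lambda>\<phi>. elliptic_F \<phi> m)"
      using elliptic_F_deriv[OF assms]
      by (intro continuous_at_imp_continuous_on ballI DERIV_isCont)
  qed simp
  moreover have "\<phi> = \<psi>" if "elliptic_F \<phi> m = elliptic_F \<psi> m" for \<phi> \<psi>
    using elliptic_F_expanding[OF assms, of \<phi> \<psi>] elliptic_F_expanding[OF assms, of \<psi> \<phi>] that
    by linarith
  ultimately show ?thesis by metis
qed

text \<open>Unique solvability makes the amplitude a two-sided inverse of the integral; later proofs
  use these equations in place of the definite description.\<close>

lemma
  assumes "0 \<le> m" "m < 1"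
  shows elliptic_F_am: "elliptic_F (jacobi_am u m) m = u"
    and am_elliptic_F: "jacobi_am (elliptic_F \<phi> m) m = \<phi>"
proof -
  have am: "jacobi_am u m = (THE \<phi>. u = elliptic_F \<phi> m)" for u
    by (simp only: jacobi_am_def elliptic_F_def)
  show "elliptic_F (jacobi_am u m) m = u"
    unfolding am by (rule theI'[OF elliptic_F_ex1[OF assms], symmetric])
  show "jacobi_am (elliptic_F \<phi> m) m = \<phi>"
    unfolding am by (rule the1_equality[OF elliptic_F_ex1[OF assms] refl])
qed

text \<open>Inverse function rule: at the amplitude the integral has slope
  \<open>1 / jacobi_dn u m\<close>.\<close>

lemma jacobi_am_deriv:
  assumes "0 \<le> m" "m < 1"
  shows "((\<lambda>u. jacobi_am u m) has_real_derivative jacobi_dn u m) (at u)"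
proof -
  let ?F = "\<lambda>\<phi>. elliptic_F \<phi> m" and ?am = "\<lambda>u. jacobi_am u m"
  let ?D = "1 / sqrt (1 - m * (sin (?am u))\<^sup>2)"
  \<comment> \<open>Continuity of an inverse is available at values of \<open>?F\<close>;
    \<open>elliptic_F_am\<close> then identifies this value with \<open>u\<close>.\<close>
  have "isCont ?am (?F (?am u))"
  proof (rule isCont_inverse_function[where f = ?F and x = "?am u" and d = 1])
    show "isCont ?F \<phi>" for \<phi> using elliptic_F_deriv[OF assms] by (rule DERIV_isCont)
  qed (simp_all add: am_elliptic_F[OF assms])
  then have cont: "isCont ?am u" by (simp add: elliptic_F_am[OF assms])
  have "?D \<noteq> 0" using elliptic_radicand_bounds(1)[OF assms, of "?am u"] by simp
  then have "(?am has_real_derivative inverse ?D) (at u)"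
    using cont elliptic_F_am[OF assms]
    by (intro DERIV_inverse_function[where f = ?F and a = "u - 1" and b = "u + 1",
          OF elliptic_F_deriv[OF assms]]) simp_all
  then show ?thesis by (simp add: jacobi_dn_def)
qed

section \<open>Calculus of the Jacobi elliptic functions\<close>

lemma jacobi_dn_pos:
  assumes "0 \<le> m" "m < 1"
  shows "0 < jacobi_dn u m"
  using elliptic_radicand_bounds(1)[OF assms] by (simp add: jacobi_dn_def)

lemma jacobi_dn_square:
  assumes "0 \<le> m" "m < 1"
  shows "(jacobi_dn u m)\<^sup>2 = 1 - m * (jacobi_sn u m)\<^sup>2"
  using elliptic_radicand_bounds(1)[OF assms, of "jacobi_am u m"]
  by (simp add: jacobi_dn_def jacobi_sn_def)

lemma jacobi_sn_deriv:
  assumes "0 \<le> m" "m < 1"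
  shows "((\<lambda>u. jacobi_sn u m) has_real_derivative jacobi_cn u m * jacobi_dn u m) (at u)"
  unfolding jacobi_sn_def jacobi_cn_def
  by (auto intro!: derivative_eq_intros jacobi_am_deriv assms)

lemma jacobi_cn_deriv:
  assumes "0 \<le> m" "m < 1"
  shows "((\<lambda>u. jacobi_cn u m) has_real_derivative - (jacobi_sn u m * jacobi_dn u m)) (at u)"
  unfolding jacobi_sn_def jacobi_cn_def
  by (auto intro!: derivative_eq_intros jacobi_am_deriv assms)

text \<open>As the root of a positive radicand, \<open>jacobi_dn\<close> is differentiable, and the
  factor \<open>jacobi_dn\<close> in the derivative of \<open>jacobi_sn\<close> cancels the inverse
  square root.\<close>

lemma jacobi_dn_deriv:
  assumes "0 \<le> m" "m < 1"
  shows "((\<lambda>u. jacobi_dn u m) has_real_derivative - (m * jacobi_sn u m * jacobi_cn u m)) (at u)"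
proof -
  define r where "r = (\<lambda>u. 1 - m * (jacobi_sn u m)\<^sup>2)"
  have dn: "jacobi_dn u m = sqrt (r u)" for u
    by (simp add: r_def jacobi_dn_def jacobi_sn_def)
  have pos: "0 < r u"
    using jacobi_dn_pos[OF assms, of u] by (simp add: dn)
  have "(r has_real_derivative 0 - m * (2 * ((jacobi_cn u m * jacobi_dn u m) * jacobi_sn u m))) (at u)"
    using DERIV_power[OF jacobi_sn_deriv[OF assms, of u], of 2] unfolding r_def
    by (intro DERIV_diff DERIV_const DERIV_cmult) simp
  note sqrt_r = DERIV_chain2[of sqrt _ r u, OF DERIV_real_sqrt[OF pos] this]
  have "inverse (sqrt (r u)) / 2 * (0 - m * (2 * (jacobi_cn u m * jacobi_dn u m * jacobi_sn u m)))
      = - (m * jacobi_sn u m * jacobi_cn u m)"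
    using jacobi_dn_pos[OF assms, of u] unfolding dn[symmetric] by (simp add: field_simps)
  from DERIV_cong[OF sqrt_r this] show ?thesis unfolding dn .
qed

text \<open>A point of the unit circle has an angle \<open>\<phi>\<close>; the argument whose
  amplitude is \<open>\<phi>\<close> is \<open>elliptic_F \<phi> m\<close>.\<close>

lemma jacobi_phase_exists:
  assumes "0 \<le> m" "m < 1" "x\<^sup>2 + y\<^sup>2 = 1"
  shows "\<exists>t. jacobi_sn t m = x \<and> jacobi_cn t m = y"
proof -
  obtain \<phi> where "y = cos \<phi>" "x = sin \<phi>"
    using sincos_total_2pi[of y x] assms(3) by (auto simp: add.commute)
  then have "jacobi_sn (elliptic_F \<phi> m) m = x" "jacobi_cn (elliptic_F \<phi> m) m = y"
    by (simp_all add: jacobi_sn_def jacobi_cn_def am_elliptic_F[OF assms(1,2)])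
  then show ?thesis by blast
qed

section \<open>Gronwall estimates\<close>

text \<open>The integrating factor \<open>exp (- K * s)\<close> turns the differential inequality
  into monotonicity: the product with \<open>E\<close> is nonincreasing and starts at 0.\<close>

lemma gronwall_zero_right:
  fixes E :: "real \<Rightarrow> real"
  assumes deriv: "\<And>s. s \<in> {0..t} \<Longrightarrow> (E has_real_derivative E' s) (at s within {0..t})"
    and bound: "\<And>s. s \<in> {0..t} \<Longrightarrow> E' s \<le> K * E s"
    and "0 \<le> t" "E 0 = 0"
  shows "E t \<le> 0"
proof -
  let ?w = "\<lambda>s. exp (- K * s) * E s"
  have w: "(?w has_real_derivative exp (- K * s) * (E' s - K * E s)) (at s within {0..t})"
    if "s \<in> {0..t}" for s
  proof -
    have "((\<lambda>s. exp (- K * s)) has_real_derivative exp (- K * s) * (- K)) (at s within {0..t})"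
      by (auto intro!: derivative_eq_intros)
    from DERIV_mult[OF this deriv[OF that]] show ?thesis by (simp add: algebra_simps)
  qed
  have "?w t \<le> ?w 0"
  proof (rule DERIV_nonpos_imp_decreasing_open[OF \<open>0 \<le> t\<close>])
    fix s assume s: "0 < s" "s < t"
    then have "(?w has_real_derivative exp (- K * s) * (E' s - K * E s)) (at s)"
      using w[of s] by (simp add: at_within_Icc_at)
    moreover have "exp (- K * s) * (E' s - K * E s) \<le> 0"
      using bound[of s] s by (simp add: mult_nonneg_nonpos)
    ultimately show "\<exists>y. (?w has_real_derivative y) (at s) \<and> y \<le> 0" by blast
  next
    show "continuous_on {0..t} ?w" using w by (rule DERIV_continuous_on)
  qed
  then show ?thesis by (simp add: assms mult_le_0_iff)
qed

text \<open>Bounding the absolute value of \<open>E'\<close> makes the hypothesis invariant under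
  time reversal, so negative \<open>t\<close> reduces to the forward estimate for
  \<open>E (- s)\<close>.\<close>

lemma gronwall_zero:
  fixes E :: "real \<Rightarrow> real"
  assumes J: "is_interval J" "0 \<in> J" "t \<in> J"
    and deriv: "\<And>s. s \<in> J \<Longrightarrow> (E has_real_derivative E' s) (at s within J)"
    and bound: "\<And>s. s \<in> J \<Longrightarrow> \<bar>E' s\<bar> \<le> K * E s"
    and "E 0 = 0"
  shows "E t \<le> 0"
proof (cases "0 \<le> t")
  case True
  then have sub: "{0..t} \<subseteq> J" using mem_is_interval_1_I[OF J] by auto
  show ?thesis
  proof (rule gronwall_zero_right[where E = E and E' = E' and K = K])
    fix s assume "s \<in> {0..t}"
    then have s: "s \<in> J" using sub by blast
    show "(E has_real_derivative E' s) (at s within {0..t})" by (rule DERIV_subset[OF deriv[OF s] sub])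
    show "E' s \<le> K * E s" using bound[OF s] by simp
  qed fact+
next
  case False
  then have sub: "{t..0} \<subseteq> J" using mem_is_interval_1_I[OF J(1,3,2)] by auto
  \<comment> \<open>The chain rule within sets needs the domain of \<open>E\<close> as an image
    under negation.\<close>
  have img: "uminus ` {0..-t} = {t..0}" by simp
  have "E (- (- t)) \<le> 0"
  proof (rule gronwall_zero_right[where E = "\<lambda>s. E (- s)" and E' = "\<lambda>s. - E' (- s)" and K = K])
    fix s assume s: "s \<in> {0..-t}"
    then have "- s \<in> {t..0}" by simp
    then have J_s: "- s \<in> J" using sub by blast
    have "(E has_real_derivative E' (- s)) (at (- s) within uminus ` {0..-t})"
      unfolding img by (rule DERIV_subset[OF deriv[OF J_s] sub])
    from DERIV_image_chain[of E _ uminus, OF this DERIV_minus[OF DERIV_ident]]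
    show "((\<lambda>s. E (- s)) has_real_derivative - E' (- s)) (at s within {0..-t})"
      by (simp add: o_def)
    show "- E' (- s) \<le> K * E (- s)" using bound[OF J_s] by linarith
  qed (use False assms(6) in simp_all)
  then show ?thesis by simp
qed

section \<open>Symmetry, conservation and uniqueness for the quadratic system\<close>

text \<open>This symmetry supplies the second conserved quantity and the case of reversed
  radii.\<close>

lemma fgh_solution_swap: "fgh_solution J f g h \<longleftrightarrow> fgh_solution J f h g"
  by (auto simp: fgh_solution_def mult.commute)

text \<open>The contributions \<open>2 * f * (g * h)\<close> and \<open>- 2 * g * (f * h)\<close> to
  the derivative cancel.\<close>

lemma fgh_conserved:
  assumes "is_interval J" "0 \<in> J" "t \<in> J" "fgh_solution J f g h"
  shows "(f t)\<^sup>2 + (g t)\<^sup>2 = (f 0)\<^sup>2 + (g 0)\<^sup>2"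
proof -
  have "((\<lambda>s. (f s)\<^sup>2 + (g s)\<^sup>2) has_real_derivative 0) (at s within J)" if "s \<in> J" for s
  proof -
    have "(f has_real_derivative g s * h s) (at s within J)"
      "(g has_real_derivative - (f s * h s)) (at s within J)"
      using assms(4) that unfolding fgh_solution_def by blast+
    from DERIV_add[OF DERIV_power[OF this(1), of 2] DERIV_power[OF this(2), of 2]]
    show ?thesis by (rule DERIV_cong) simp
  qed
  from has_field_derivative_zero_constant[OF is_interval_convex[OF assms(1)] this]
  obtain c where "\<And>s. s \<in> J \<Longrightarrow> (f s)\<^sup>2 + (g s)\<^sup>2 = c" by blast
  then show ?thesis using assms(2,3) by simp
qed

text \<open>The squared distance \<open>E\<close> of two solutions vanishes at 0 and satisfies a
  Gronwall inequality whose constant comes from the conserved radius.\<close>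

lemma fgh_unique:
  assumes J: "is_interval J" "0 \<in> J" "t \<in> J"
    and sol: "fgh_solution J f g h" "fgh_solution J F G H"
    and init: "f 0 = F 0" "g 0 = G 0" "h 0 = H 0"
  shows "f t = F t \<and> g t = G t \<and> h t = H t"
proof -
  define r where "r = radius0 f g"
  define E where "E = (\<lambda>s. (f s - F s)\<^sup>2 + (g s - G s)\<^sup>2 + (h s - H s)\<^sup>2)"
  \<comment> \<open>Expanding the derivative of \<open>E\<close> in the three differences, the terms
    carrying \<open>g\<close> or \<open>h\<close> as coefficients cancel. The first factor equals
    \<open>- (f s + F s)\<close>.\<close>
  define E' where "E' = (\<lambda>s. 2 * ((f s - F s) - 2 * f s) * ((g s - G s) * (h s - H s)))"
  have "E t \<le> 0"
  proof (rule gronwall_zero[OF J, where E = E and E' = E' and K = "2 * r"])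
    fix s assume s: "s \<in> J"
    show "(E has_real_derivative E' s) (at s within J)"
    proof -
      have d: "(f has_real_derivative g s * h s) (at s within J)"
        "(g has_real_derivative - (f s * h s)) (at s within J)"
        "(h has_real_derivative - (f s * g s)) (at s within J)"
        "(F has_real_derivative G s * H s) (at s within J)"
        "(G has_real_derivative - (F s * H s)) (at s within J)"
        "(H has_real_derivative - (F s * G s)) (at s within J)"
        using sol s unfolding fgh_solution_def by blast+
      note sq = DERIV_power[where n = 2]
      note D = DERIV_add[OF DERIV_add[OF sq[OF DERIV_diff[OF d(1,4)]] sq[OF DERIV_diff[OF d(2,5)]]]
          sq[OF DERIV_diff[OF d(3,6)]]]
      show ?thesis
        unfolding E_def E'_def by (rule DERIV_cong[OF D]) (simp, algebra)
    qed
    \<comment> \<open>Equal initial data give both solutions the same radius \<open>r\<close>, which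
      bounds \<open>f\<close> and \<open>F\<close>.\<close>
    have "(f s)\<^sup>2 + (g s)\<^sup>2 = r\<^sup>2" "(F s)\<^sup>2 + (G s)\<^sup>2 = r\<^sup>2"
      using fgh_conserved[OF J(1,2) s sol(1)] fgh_conserved[OF J(1,2) s sol(2)] init
      by (auto simp: r_def radius0_def)
    then have "(f s)\<^sup>2 \<le> r\<^sup>2" "(F s)\<^sup>2 \<le> r\<^sup>2"
      using zero_le_power2[of "g s"] zero_le_power2[of "G s"] by linarith+
    moreover have "0 \<le> r" by (simp add: r_def radius0_def)
    ultimately have "\<bar>f s\<bar> \<le> r" "\<bar>F s\<bar> \<le> r"
      using abs_le_square_iff[of "f s" r] abs_le_square_iff[of "F s" r] by simp_all
    then have 1: "\<bar>(f s - F s) - 2 * f s\<bar> \<le> 2 * r" by linarith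
    have 2: "2 * \<bar>(g s - G s) * (h s - H s)\<bar> \<le> E s"
    proof -
      have "2 * (\<bar>g s - G s\<bar> * \<bar>h s - H s\<bar>) \<le> (g s - G s)\<^sup>2 + (h s - H s)\<^sup>2"
        using sum_squares_bound[of "\<bar>g s - G s\<bar>" "\<bar>h s - H s\<bar>"] by simp
      also have "\<dots> \<le> E s" by (simp add: E_def)
      finally show ?thesis by (simp add: abs_mult)
    qed
    have "\<bar>E' s\<bar> = \<bar>(f s - F s) - 2 * f s\<bar> * (2 * \<bar>(g s - G s) * (h s - H s)\<bar>)"
      by (simp only: E'_def abs_mult abs_numeral mult.commute mult.left_commute)
    also have "\<dots> \<le> 2 * r * E s"
      using 1 2 \<open>0 \<le> r\<close> by (intro mult_mono) auto
    finally show "\<bar>E' s\<bar> \<le> 2 * r * E s" .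
  qed (simp add: E_def init)
  then have "(f t - F t)\<^sup>2 = 0 \<and> (g t - G t)\<^sup>2 = 0 \<and> (h t - H t)\<^sup>2 = 0"
    using zero_le_power2[of "f t - F t"] zero_le_power2[of "g t - G t"] zero_le_power2[of "h t - H t"]
    unfolding E_def by linarith
  then show ?thesis by simp
qed

section \<open>Elliptic, hyperbolic and constant solutions\<close>

text \<open>\<open>B\<close> is both the amplitude of \<open>jacobi_dn\<close> and the speed of the
  argument, and may be negative so as to absorb the sign of \<open>h\<close>. The first two
  equations are the chain rule; the third uses \<open>B * (B * m) = A * A\<close>.\<close>

lemma fgh_solution_elliptic:
  assumes "\<bar>A\<bar> < \<bar>B\<bar>"
  defines "m \<equiv> A\<^sup>2 / B\<^sup>2"
  shows "fgh_solution J (\<lambda>t. A * jacobi_sn (B * t + t0) m) (\<lambda>t. A * jacobi_cn (B * t + t0) m)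
    (\<lambda>t. B * jacobi_dn (B * t + t0) m)"
proof -
  have m: "0 \<le> m" "m < 1"
    using assms by (auto simp: m_def divide_less_eq_1 abs_square_less_1 power2_strict_mono)
  have Bm: "B * (B * m) = A * A"
    using assms by (auto simp: m_def power2_eq_square)
  have lin: "((\<lambda>t. B * t + t0) has_real_derivative B) (at t within J)" for t
    by (auto intro!: derivative_eq_intros)
  note chain = DERIV_chain2[OF jacobi_sn_deriv[OF m] lin] DERIV_chain2[OF jacobi_cn_deriv[OF m] lin]
    DERIV_chain2[OF jacobi_dn_deriv[OF m] lin]
  show ?thesis
    unfolding fgh_solution_def
  proof (intro ballI conjI)
    fix t assume "t \<in> J"
    show "((\<lambda>t. A * jacobi_sn (B * t + t0) m) has_real_derivative
        A * jacobi_cn (B * t + t0) m * (B * jacobi_dn (B * t + t0) m)) (at t within J)"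
      by (rule DERIV_cong[OF DERIV_cmult[OF chain(1)]]) simp
    show "((\<lambda>t. A * jacobi_cn (B * t + t0) m) has_real_derivative
        - (A * jacobi_sn (B * t + t0) m * (B * jacobi_dn (B * t + t0) m))) (at t within J)"
      by (rule DERIV_cong[OF DERIV_cmult[OF chain(2)]]) simp
    have "B * (- (m * jacobi_sn (B * t + t0) m * jacobi_cn (B * t + t0) m) * B) =
        - ((B * (B * m)) * jacobi_sn (B * t + t0) m * jacobi_cn (B * t + t0) m)" by simp
    then show "((\<lambda>t. B * jacobi_dn (B * t + t0) m) has_real_derivative
        - (A * jacobi_sn (B * t + t0) m * (A * jacobi_cn (B * t + t0) m))) (at t within J)"
      unfolding Bm by (intro DERIV_cong[OF DERIV_cmult[OF chain(3)]]) simp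
  qed
qed

lemma tanh_square_sech: "(tanh x)\<^sup>2 = 1 - (sech x)\<^sup>2" for x :: real
proof -
  have "(tanh x)\<^sup>2 + (sech x)\<^sup>2 = ((sinh x)\<^sup>2 + 1) / (cosh x)\<^sup>2"
    by (simp add: tanh_def sech_def power_divide add_divide_distrib)
  also have "\<dots> = 1" by (simp flip: cosh_square_eq)
  finally show ?thesis by simp
qed

lemma sech_deriv: "(sech has_real_derivative - (tanh x * sech x)) (at x)"
  unfolding sech_def[abs_def]
  by (auto intro!: derivative_eq_intros simp: tanh_def power2_eq_square)

lemma tanh_deriv_sech: "(tanh has_real_derivative (sech x)\<^sup>2) (at x)" for x :: real
  by (auto intro!: derivative_eq_intros simp: tanh_square_sech)

text \<open>\<open>artanh\<close> is half a logarithm, so \<open>exp (- 2 * artanh x)\<close> is the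
  rational function \<open>(1 - x) / (1 + x)\<close>, which is put into the exponential form of
  \<open>tanh\<close>.\<close>

lemma tanh_artanh_real:
  fixes x :: real
  assumes "\<bar>x\<bar> < 1"
  shows "tanh (artanh x) = x"
proof -
  have "0 < (1 + x) / (1 - x)" using assms by simp
  moreover have "- 2 * artanh x = - ln ((1 + x) / (1 - x))" by (simp add: artanh_def)
  ultimately have "exp (- 2 * artanh x) = (1 - x) / (1 + x)"
    by (simp add: exp_minus)
  then have "tanh (artanh x) = (1 - (1 - x) / (1 + x)) / (1 + (1 - x) / (1 + x))"
    by (simp only: tanh_real_altdef)
  also have "\<dots> = x" using assms by (simp add: divide_simps)
  finally show ?thesis .
qed

lemma sech_artanh:
  fixes x :: real
  assumes "\<bar>x\<bar> < 1"
  shows "sech (artanh x) = sqrt (1 - x\<^sup>2)"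
proof -
  have "(sech (artanh x))\<^sup>2 = 1 - x\<^sup>2"
    using tanh_square_sech[of "artanh x"] assms by (simp add: tanh_artanh_real)
  moreover have "0 < sech (artanh x)" by (simp add: sech_def)
  ultimately show ?thesis by (metis less_imp_le real_sqrt_unique)
qed

text \<open>\<open>\<alpha>\<close> and \<open>\<beta>\<close> are the signs of \<open>g\<close> and
  \<open>h\<close>. With \<open>\<sigma> = \<alpha> * \<beta>\<close>, multiplying one of the signs
  by \<open>\<sigma>\<close> gives the other, as the equations for \<open>g\<close> and
  \<open>h\<close> require.\<close>

lemma fgh_solution_hyperbolic:
  assumes "\<alpha>\<^sup>2 = 1" "\<beta>\<^sup>2 = 1" "\<sigma> = \<alpha> * \<beta>"
  shows "fgh_solution J (\<lambda>t. r * tanh (\<sigma> * r * t + t0)) (\<lambda>t. \<alpha> * r * sech (\<sigma> * r * t + t0))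
    (\<lambda>t. \<beta> * r * sech (\<sigma> * r * t + t0))"
proof -
  have lin: "((\<lambda>t. \<sigma> * r * t + t0) has_real_derivative \<sigma> * r) (at t within J)" for t
    by (auto intro!: derivative_eq_intros)
  note chain = DERIV_chain2[OF tanh_deriv_sech lin] DERIV_chain2[OF sech_deriv lin]
  have sq: "\<alpha> * \<alpha> = 1" "\<beta> * \<beta> = 1" using assms by (auto simp: power2_eq_square)
  have signs: "\<alpha> * \<sigma> = \<beta>" "\<beta> * \<sigma> = \<alpha>"
    unfolding assms(3) using sq by (metis mult.assoc mult.left_commute mult_1 mult.right_neutral)+
  show ?thesis
    unfolding fgh_solution_def
  proof (intro ballI conjI)
    fix t assume "t \<in> J"
    show "((\<lambda>t. r * tanh (\<sigma> * r * t + t0)) has_real_derivative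
        \<alpha> * r * sech (\<sigma> * r * t + t0) * (\<beta> * r * sech (\<sigma> * r * t + t0))) (at t within J)"
      by (rule DERIV_cong[OF DERIV_cmult[OF chain(1)]]) (simp add: assms(3) power2_eq_square)
    have "\<alpha> * r * (- (tanh (\<sigma> * r * t + t0) * sech (\<sigma> * r * t + t0)) * (\<sigma> * r)) =
        - (r * tanh (\<sigma> * r * t + t0) * ((\<alpha> * \<sigma>) * r * sech (\<sigma> * r * t + t0)))" by simp
    then show "((\<lambda>t. \<alpha> * r * sech (\<sigma> * r * t + t0)) has_real_derivative
        - (r * tanh (\<sigma> * r * t + t0) * (\<beta> * r * sech (\<sigma> * r * t + t0)))) (at t within J)"
      unfolding signs by (intro DERIV_cong[OF DERIV_cmult[OF chain(2)]]) simp
    have "\<beta> * r * (- (tanh (\<sigma> * r * t + t0) * sech (\<sigma> * r * t + t0)) * (\<sigma> * r)) =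
        - (r * tanh (\<sigma> * r * t + t0) * ((\<beta> * \<sigma>) * r * sech (\<sigma> * r * t + t0)))" by simp
    then show "((\<lambda>t. \<beta> * r * sech (\<sigma> * r * t + t0)) has_real_derivative
        - (r * tanh (\<sigma> * r * t + t0) * (\<alpha> * r * sech (\<sigma> * r * t + t0)))) (at t within J)"
      unfolding signs by (intro DERIV_cong[OF DERIV_cmult[OF chain(2)]]) simp
  qed
qed

text \<open>The equilibria, where all pairwise products vanish; they cover cases (i) and
  (iii).\<close>

lemma fgh_solution_const:
  assumes "a * b = 0" "a * c = 0" "b * c = 0"
  shows "fgh_solution J (\<lambda>t. a) (\<lambda>t. b) (\<lambda>t. c)"
  using assms by (auto simp: fgh_solution_def)

section \<open>Matching the initial data\<close>

text \<open>\<open>r < R\<close> means that \<open>c\<^sup>2\<close> exceeds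
  \<open>b\<^sup>2\<close>, and \<open>(a / r, b / r)\<close> lies on the unit circle. The value of
  \<open>jacobi_dn\<close> is fixed by that of \<open>jacobi_sn\<close>:
  \<open>R * jacobi_dn t0 m\<close> is the positive root of
  \<open>R\<^sup>2 - a\<^sup>2 = c\<^sup>2\<close>.\<close>

lemma elliptic_initial:
  fixes a b c :: real
  defines "r \<equiv> sqrt (a\<^sup>2 + b\<^sup>2)" and "R \<equiv> sqrt (a\<^sup>2 + c\<^sup>2)"
  defines "m \<equiv> r\<^sup>2 / R\<^sup>2"
  assumes "r < R" "0 < r"
  shows "c \<noteq> 0"
    and "\<exists>t0. jacobi_sn t0 m = a / r \<and> jacobi_cn t0 m = b / r"
    and "jacobi_sn t0 m = a / r \<Longrightarrow> c = sgn c * R * jacobi_dn t0 m"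
proof -
  have R: "0 < R" using assms(4,5) by linarith
  have sq: "r\<^sup>2 = a\<^sup>2 + b\<^sup>2" "R\<^sup>2 = a\<^sup>2 + c\<^sup>2"
    unfolding r_def R_def by simp_all
  have "r\<^sup>2 < R\<^sup>2" using assms(4,5) by (intro power_strict_mono) auto
  then show "c \<noteq> 0" using sq by auto
  have m: "0 \<le> m" "m < 1" using R \<open>r\<^sup>2 < R\<^sup>2\<close> by (simp_all add: m_def)
  have "(a / r)\<^sup>2 + (b / r)\<^sup>2 = r\<^sup>2 / r\<^sup>2"
    by (simp only: power_divide add_divide_distrib sq(1))
  then have "(a / r)\<^sup>2 + (b / r)\<^sup>2 = 1"
    using assms(5) by simp
  from jacobi_phase_exists[OF m this]
  show "\<exists>t0. jacobi_sn t0 m = a / r \<and> jacobi_cn t0 m = b / r" .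
  assume sn: "jacobi_sn t0 m = a / r"
  have "(R * jacobi_dn t0 m)\<^sup>2 = R\<^sup>2 * (1 - m * (a / r)\<^sup>2)"
    by (simp add: power_mult_distrib jacobi_dn_square[OF m] sn)
  also have "\<dots> = R\<^sup>2 - a\<^sup>2"
    using R assms(5) by (simp add: m_def right_diff_distrib power_divide)
  also have "\<dots> = \<bar>c\<bar>\<^sup>2" by (simp add: sq)
  finally have "R * jacobi_dn t0 m = \<bar>c\<bar>"
    by (rule power2_eq_imp_eq) (use R jacobi_dn_pos[OF m, of t0] in simp_all)
  then show "c = sgn c * R * jacobi_dn t0 m"
    by (simp add: mult.assoc sgn_mult_abs)
qed

text \<open>Equal radii give \<open>b\<^sup>2 = c\<^sup>2\<close>, nonzero, so \<open>a / R\<close>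
  lies strictly between -1 and 1. Then \<open>R * sech (artanh (a / R))\<close> is the root of
  \<open>R\<^sup>2 - a\<^sup>2\<close>, the common absolute value of \<open>b\<close> and
  \<open>c\<close>; \<open>sgn\<close> restores the signs.\<close>

lemma hyperbolic_initial:
  fixes a b c :: real
  defines "R \<equiv> sqrt (a\<^sup>2 + c\<^sup>2)"
  assumes "sqrt (a\<^sup>2 + b\<^sup>2) = R" "b \<noteq> 0"
  shows "\<bar>c\<bar> = \<bar>b\<bar>" "a = R * tanh (artanh (a / R))"
    and "b = sgn b * R * sech (artanh (a / R))" "c = sgn c * R * sech (artanh (a / R))"
proof -
  have "a\<^sup>2 + b\<^sup>2 = a\<^sup>2 + c\<^sup>2" using assms(2) unfolding R_def by simp
  then have "b\<^sup>2 = c\<^sup>2" by simp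
  then show bc: "\<bar>c\<bar> = \<bar>b\<bar>" by (auto simp: power2_eq_iff)
  have R2: "R\<^sup>2 = a\<^sup>2 + c\<^sup>2" by (simp add: R_def)
  have c: "0 < c\<^sup>2" using bc assms(3) by auto
  have R: "0 < R" unfolding R_def using c by (simp add: add_nonneg_pos)
  have "\<bar>a\<bar> < R" unfolding R_def using c by (intro real_less_rsqrt) simp
  then have lt: "\<bar>a / R\<bar> < 1" using R by simp
  show "a = R * tanh (artanh (a / R))" using lt R by (simp add: tanh_artanh_real)
  have "R * sech (artanh (a / R)) = sqrt (R\<^sup>2 * (1 - (a / R)\<^sup>2))"
    using R by (simp add: sech_artanh[OF lt] real_sqrt_mult)
  also have "R\<^sup>2 * (1 - (a / R)\<^sup>2) = R\<^sup>2 - a\<^sup>2"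
    using R by (simp add: right_diff_distrib power_divide)
  also have "\<dots> = c\<^sup>2" by (simp add: R2)
  finally have *: "R * sech (artanh (a / R)) = \<bar>c\<bar>" by simp
  show "c = sgn c * R * sech (artanh (a / R))" using * by (simp add: mult.assoc sgn_mult_abs)
  show "b = sgn b * R * sech (artanh (a / R))" using * bc by (simp add: mult.assoc sgn_mult_abs)
qed

section \<open>Global existence and the explicit formulas\<close>

text \<open>The explicit functions are defined for all times, so they serve as witnesses, one family
  for each case.\<close>

lemma fgh_exists_ordered:
  fixes a b c :: real
  assumes "sqrt (a\<^sup>2 + b\<^sup>2) \<le> sqrt (a\<^sup>2 + c\<^sup>2)"
  shows "\<exists>f g h. fgh_solution UNIV f g h \<and> f 0 = a \<and> g 0 = b \<and> h 0 = c"
proof -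
  let ?r = "sqrt (a\<^sup>2 + b\<^sup>2)" and ?R = "sqrt (a\<^sup>2 + c\<^sup>2)"
  consider "?r = 0" | "?r < ?R" "0 < ?r" | "?r = ?R" "b = 0" | "?r = ?R" "b \<noteq> 0"
    using assms by (smt (verit) real_sqrt_ge_zero sum_power2_ge_zero)
  note cases = this
  have witness: ?thesis if "fgh_solution UNIV f g h" "f 0 = a" "g 0 = b" "h 0 = c" for f g h
    using that by blast
  from cases show ?thesis
  proof cases
    case 1
    then have "a = 0" "b = 0" by (auto simp: sum_power2_eq_zero_iff)
    then show ?thesis by (intro witness[OF fgh_solution_const[of a b c]]) simp_all
  next
    case 2
    note init = elliptic_initial[OF 2]
    from init(2) obtain t0 where t0: "jacobi_sn t0 (?r\<^sup>2 / ?R\<^sup>2) = a / ?r" "jacobi_cn t0 (?r\<^sup>2 / ?R\<^sup>2) = b / ?r"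
      by blast
    \<comment> \<open>With \<open>sgn c * ?R\<close> as the speed, the elliptic parameter is the
      quotient by its square; the first equation removes the sign.\<close>
    have B: "(sgn c * ?R)\<^sup>2 = ?R\<^sup>2" "\<bar>?r\<bar> < \<bar>sgn c * ?R\<bar>"
      using init(1) 2 by (auto simp: power_mult_distrib abs_mult sgn_if)
    show ?thesis
    proof (rule witness[OF fgh_solution_elliptic[OF B(2), of UNIV t0, unfolded B(1)]])
      show "?r * jacobi_sn (sgn c * ?R * 0 + t0) (?r\<^sup>2 / ?R\<^sup>2) = a"
        "?r * jacobi_cn (sgn c * ?R * 0 + t0) (?r\<^sup>2 / ?R\<^sup>2) = b"
        using t0 2 by simp_all
      show "sgn c * ?R * jacobi_dn (sgn c * ?R * 0 + t0) (?r\<^sup>2 / ?R\<^sup>2) = c"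
        using init(3)[OF t0(1), symmetric] by simp
    qed
  next
    case 3
    then have "a\<^sup>2 + b\<^sup>2 = a\<^sup>2 + c\<^sup>2" by (simp only: real_sqrt_eq_iff)
    with 3 have "c = 0" by simp
    with 3 show ?thesis by (intro witness[OF fgh_solution_const[of a b c]]) simp_all
  next
    case 4
    note init = hyperbolic_initial[OF 4]
    have "(sgn b)\<^sup>2 = 1" "(sgn c)\<^sup>2 = 1" using init(1) 4 by (auto simp: sgn_if)
    from fgh_solution_hyperbolic[OF this refl, of UNIV ?R "artanh (a / ?R)"]
    show ?thesis by (rule witness) (use init(2-4)[symmetric] in simp_all)
  qed
qed

lemma fgh_exists:
  fixes a b c :: real
  shows "\<exists>f g h. fgh_solution UNIV f g h \<and> f 0 = a \<and> g 0 = b \<and> h 0 = c"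
proof (cases "sqrt (a\<^sup>2 + b\<^sup>2) \<le> sqrt (a\<^sup>2 + c\<^sup>2)")
  case True
  then show ?thesis by (rule fgh_exists_ordered)
next
  case False
  then have "\<exists>f g h. fgh_solution UNIV f g h \<and> f 0 = a \<and> g 0 = c \<and> h 0 = b"
    by (intro fgh_exists_ordered) simp
  then show ?thesis using fgh_solution_swap by blast
qed

text \<open>Each clause of \<open>explicit_formulas\<close> carries its own condition on the radii
  and is proved separately: the listed functions solve the system and agree with the solution at 0,
  so \<open>fgh_unique\<close> applies.\<close>

lemma explicit_formulas_solution:
  assumes J: "is_interval J" "0 \<in> J" and sol: "fgh_solution J f g h"
  shows "explicit_formulas J f g h"
proof -
  let ?r = "radius0 f g" and ?R = "radius0 f h"
  note unique = fgh_unique[OF J _ sol]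
  have i: "f t = 0 \<and> g t = 0 \<and> h t = h 0" if "?r = 0" "t \<in> J" for t
  proof -
    have "f 0 = 0" "g 0 = 0" using that by (auto simp: radius0_def sum_power2_eq_zero_iff)
    then show ?thesis
      using unique[OF that(2) fgh_solution_const[of 0 0 "h 0"]] by simp
  qed
  have iii: "f t = f 0 \<and> g t = 0 \<and> h t = 0" if "g 0 = 0" "h 0 = 0" "t \<in> J" for t
    using unique[OF that(3) fgh_solution_const[of "f 0" 0 0]] that by simp
  \<comment> \<open>\<open>t0\<close> is arbitrary among the valid phases, since the formulas are
    claimed for each of them; \<open>phase\<close> below shows that one exists.\<close>
  have ii: "f t = ?r * jacobi_sn (sgn (h 0) * ?R * t + t0) (?r\<^sup>2 / ?R\<^sup>2) \<and>
      g t = ?r * jacobi_cn (sgn (h 0) * ?R * t + t0) (?r\<^sup>2 / ?R\<^sup>2) \<and>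
      h t = sgn (h 0) * ?R * jacobi_dn (sgn (h 0) * ?R * t + t0) (?r\<^sup>2 / ?R\<^sup>2)"
    if "?r < ?R" "0 < ?r" "t \<in> J" "jacobi_sn t0 (?r\<^sup>2 / ?R\<^sup>2) = f 0 / ?r"
      "jacobi_cn t0 (?r\<^sup>2 / ?R\<^sup>2) = g 0 / ?r" for t t0
  proof -
    note init = elliptic_initial[OF that(1,2)[unfolded radius0_def], folded radius0_def]
    have B: "(sgn (h 0) * ?R)\<^sup>2 = ?R\<^sup>2" "\<bar>?r\<bar> < \<bar>sgn (h 0) * ?R\<bar>"
      using init(1) that by (auto simp: power_mult_distrib abs_mult sgn_if)
    show ?thesis
      using that init(3)[OF that(4), symmetric]
      by (intro unique[OF _ fgh_solution_elliptic[OF B(2), of J t0, unfolded B(1)]]) simp_all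
  qed
  have iv: "f t = ?R * tanh (sgn (g 0 * h 0) * ?R * t + artanh (f 0 / ?R)) \<and>
      g t = sgn (g 0) * ?R * sech (sgn (g 0 * h 0) * ?R * t + artanh (f 0 / ?R)) \<and>
      h t = sgn (h 0) * ?R * sech (sgn (g 0 * h 0) * ?R * t + artanh (f 0 / ?R))"
    if "?R = ?r" "g 0 \<noteq> 0" "t \<in> J" for t
  proof -
    note init = hyperbolic_initial[OF that(1)[symmetric, unfolded radius0_def] that(2), folded radius0_def]
    have "(sgn (g 0))\<^sup>2 = 1" "(sgn (h 0))\<^sup>2 = 1" using init(1) that by (auto simp: sgn_if)
    from unique[OF that(3) fgh_solution_hyperbolic[OF this sgn_mult, of J ?R "artanh (f 0 / ?R)"]]
    show ?thesis using init(2-4)[symmetric] by simp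
  qed
  have phase: "h 0 \<noteq> 0 \<and> (\<exists>t0. jacobi_sn t0 (?r\<^sup>2 / ?R\<^sup>2) = f 0 / ?r \<and> jacobi_cn t0 (?r\<^sup>2 / ?R\<^sup>2) = g 0 / ?r)"
    if "?r < ?R" "0 < ?r"
    using elliptic_initial(1,2)[OF that[unfolded radius0_def]] unfolding radius0_def by blast
  have nonzero: "\<bar>h 0\<bar> = \<bar>g 0\<bar> \<and> \<bar>g 0\<bar> > 0" if "?R = ?r" "g 0 \<noteq> 0"
    using hyperbolic_initial(1)[OF that(1)[symmetric, unfolded radius0_def] that(2)] that(2) by simp
  show ?thesis
    unfolding explicit_formulas_def Let_def prod.inject
    using i ii iii iv phase nonzero by blast
qed

section \<open>Translation to the original system\<close>

lemma DRI_solution_iff: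
  "DRI_solution p3 J D R I \<longleftrightarrow>
     (\<forall>t\<in>J. (D has_real_derivative - 2 * p3 * I t * R t) (at t within J) \<and>
            (R has_real_derivative - 2 * p3 * I t * D t) (at t within J) \<and>
            (I has_real_derivative 4 * p3 * D t * R t) (at t within J))"
proof -
  \<comment> \<open>The projections are bounded linear; since triples are nested pairs, they are
    applied a second time to the inner pair.\<close>
  have "((\<lambda>s. (D s, R s, I s)) has_vector_derivative (d, r, i)) (at t within J) \<longleftrightarrow>
      (D has_vector_derivative d) (at t within J) \<and> (R has_vector_derivative r) (at t within J) \<and>
      (I has_vector_derivative i) (at t within J)"
    for d r i t
    using bounded_linear.has_vector_derivative[OF bounded_linear_fst, of "\<lambda>s. (D s, R s, I s)" "(d, r, i)" "at t within J"]
      bounded_linear.has_vector_derivative[OF bounded_linear_snd, of "\<lambda>s. (D s, R s, I s)" "(d, r, i)" "at t within J"]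
      bounded_linear.has_vector_derivative[OF bounded_linear_fst, of "\<lambda>s. (R s, I s)" "(r, i)" "at t within J"]
      bounded_linear.has_vector_derivative[OF bounded_linear_snd, of "\<lambda>s. (R s, I s)" "(r, i)" "at t within J"]
    by (auto intro: has_vector_derivative_Pair)
  then show ?thesis
    by (simp add: DRI_solution_def DRI_field_def has_real_derivative_iff_has_vector_derivative)
qed

text \<open>The scaling works because \<open>sqrt 8 * sqrt 8 = 2 * 4\<close>. One direction
  transports the formulas, the other transports existence back.\<close>

lemma DRI_fgh_solution:
  "DRI_solution 1 J D R I \<longleftrightarrow>
    fgh_solution J (\<lambda>t. 2 * I t) (\<lambda>t. sqrt 8 * R t) (\<lambda>t. sqrt 8 * D t)"
proof -
  have cmult: "((\<lambda>t. c * u t) has_real_derivative c * u') (at t within J) \<longleftrightarrow>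
      (u has_real_derivative u') (at t within J)"
    if "c \<noteq> 0" for c u' t :: real and u
    using DERIV_cmult[of u u' t J c] DERIV_cmult[of "\<lambda>t. c * u t" "c * u'" t J "1 / c"] that by auto
  have nz: "(2::real) \<noteq> 0" "sqrt 8 \<noteq> 0" by simp_all
  have s: "sqrt 8 * R t * (sqrt 8 * D t) = 2 * (4 * D t * R t)" for t
    by (simp add: algebra_simps)
  have g: "- (2 * I t * (sqrt 8 * D t)) = sqrt 8 * (- 2 * I t * D t)"
    "- (2 * I t * (sqrt 8 * R t)) = sqrt 8 * (- 2 * I t * R t)" for t by simp_all
  show ?thesis
    unfolding DRI_solution_iff fgh_solution_def s g cmult[OF nz(1)] cmult[OF nz(2)] by auto
qed

theorem proposition2p5:
  fixes p3 \<rho> :: real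
  assumes "p3 = 1" and "\<rho> > 0"
  shows
    "(\<forall>p \<in> {(\<rho>, 0, 0), (-\<rho>, 0, 0), (0, \<rho>, 0), (0, -\<rho>, 0), (0, 0, \<rho>), (0, 0, -\<rho>)}.
        DRI_fixed_point p3 \<rho> p) \<and>
     (\<forall>p0 \<in> sphere2 \<rho>. \<exists>D R I. DRI_solution p3 UNIV D R I \<and> (D 0, R 0, I 0) = p0) \<and>
     (\<forall>J D R I.
        is_interval J \<and> 0 \<in> J \<and> DRI_solution p3 J D R I \<and> (D 0, R 0, I 0) \<in> sphere2 \<rho> \<longrightarrow>
        (\<forall>t\<in>J. (D t, R t, I t) \<in> sphere2 \<rho>) \<and>
        (let f = (\<lambda>t. 2 * p3 * I t);
             g = (\<lambda>t. sqrt 8 * p3 * R t);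
             h = (\<lambda>t. sqrt 8 * p3 * D t);
             Rfg = radius0 f g;
             Rfh = radius0 f h
         in fgh_solution J f g h \<and>
            (\<forall>t\<in>J. (f t)\<^sup>2 + (g t)\<^sup>2 = Rfg\<^sup>2 \<and> (f t)\<^sup>2 + (h t)\<^sup>2 = Rfh\<^sup>2) \<and>
            (Rfh \<ge> Rfg \<longrightarrow> explicit_formulas J f g h) \<and>
            (Rfh < Rfg \<longrightarrow> explicit_formulas J f h g)))"
proof -
  have fixed: "\<forall>p \<in> {(\<rho>, 0, 0), (-\<rho>, 0, 0), (0, \<rho>, 0), (0, -\<rho>, 0), (0, 0, \<rho>), (0, 0, -\<rho>)}.
      DRI_fixed_point p3 \<rho> p"
    by (auto simp: DRI_fixed_point_def sphere2_def DRI_field_def zero_prod_def)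
  have exist: "\<exists>D R I. DRI_solution p3 UNIV D R I \<and> (D 0, R 0, I 0) = (d, r, i)" for d r i
  proof -
    obtain f g h where "fgh_solution UNIV f g h" "f 0 = 2 * i" "g 0 = sqrt 8 * r" "h 0 = sqrt 8 * d"
      using fgh_exists by blast
    then show ?thesis
      unfolding assms(1) DRI_fgh_solution
      \<comment> \<open>The witnesses invert the scaling.\<close>
      by (intro exI[of _ "\<lambda>t. h t / sqrt 8"] exI[of _ "\<lambda>t. g t / sqrt 8"] exI[of _ "\<lambda>t. f t / 2"]) simp
  qed
  have main: "(\<forall>t\<in>J. (D t, R t, I t) \<in> sphere2 \<rho>) \<and>
        (let f = (\<lambda>t. 2 * p3 * I t);
             g = (\<lambda>t. sqrt 8 * p3 * R t);
             h = (\<lambda>t. sqrt 8 * p3 * D t);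
             Rfg = radius0 f g;
             Rfh = radius0 f h
         in fgh_solution J f g h \<and>
            (\<forall>t\<in>J. (f t)\<^sup>2 + (g t)\<^sup>2 = Rfg\<^sup>2 \<and> (f t)\<^sup>2 + (h t)\<^sup>2 = Rfh\<^sup>2) \<and>
            (Rfh \<ge> Rfg \<longrightarrow> explicit_formulas J f g h) \<and>
            (Rfh < Rfg \<longrightarrow> explicit_formulas J f h g))"
    if J: "is_interval J" "0 \<in> J" and DRI: "DRI_solution p3 J D R I"
      and init: "(D 0, R 0, I 0) \<in> sphere2 \<rho>" for J D R I
  proof -
    define f g h where "f = (\<lambda>t. 2 * I t)" and "g = (\<lambda>t. sqrt 8 * R t)" and "h = (\<lambda>t. sqrt 8 * D t)"
    have sol: "fgh_solution J f g h"
      using DRI unfolding assms(1) DRI_fgh_solution f_def g_def h_def .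
    then have sol': "fgh_solution J f h g" using fgh_solution_swap by blast
    note cons = fgh_conserved[OF J _ sol] fgh_conserved[OF J _ sol']
    \<comment> \<open>The two conserved quantities add up to 8 times the squared norm of
      \<open>(D t, R t, I t)\<close>.\<close>
    have "(D t, R t, I t) \<in> sphere2 \<rho>" if "t \<in> J" for t
      using cons[OF that] init by (simp add: f_def g_def h_def sphere2_def power_mult_distrib)
    moreover have "(f t)\<^sup>2 + (g t)\<^sup>2 = (radius0 f g)\<^sup>2 \<and> (f t)\<^sup>2 + (h t)\<^sup>2 = (radius0 f h)\<^sup>2" if "t \<in> J" for t
      using cons[OF that] by (simp add: radius0_def)
    ultimately show ?thesis
      using sol explicit_formulas_solution[OF J sol] explicit_formulas_solution[OF J sol']
      unfolding Let_def assms(1) mult_1_right f_def g_def h_def by blast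
  qed
  show ?thesis
    using fixed exist main by (intro conjI ballI allI impI) (auto simp: split_paired_all)
qed

end
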